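(* Let $\hat{\mathbf Q}\in\hat{\mathbb{Q}}^{n\times n}$ be a dual quaternion matrix, $\hat{\mathbf v}\in\hat{\mathbb{Q}}^{n\times 1}$ a dual quaternion vector, and $\hat\lambda=\lambda_1+\lambda_2\varepsilon\in\mathbb{DC}$ a dual complex number. Put $\hat P=\mathcal J(\hat{\mathbf Q})$, $\hat{\mathbf u}_1=\mathcal F(\hat{\mathbf v})$ and $\hat{\mathbf u}_2=\mathcal F(\hat{\mathbf v}\mathbf j)$. Then $$\hat{\mathbf Q}\hat{\mathbf v}=\hat{\mathbf v}\hat\lambda$$ is equivalent to $$\hat P\hat{\mathbf u}_1=\hat\lambda\hat{\mathbf u}_1\quad\text{or}\quad \hat P\hat{\mathbf u}_2=\overline{\hat\lambda}\,\hat{\mathbf u}_2 .$$ In addition, $\hat{\mathbf u}_1$ and $\hat{\mathbf u}_2$ are orthogonal, i.e. $\hat{\mathbf u}_1^*\hat{\mathbf u}_2=\hat{\mathbf u}_2^*\hat{\mathbf u}_1=\hat 0$.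
   Context: $\varepsilon$ is the infinitesimal unit: $\varepsilon\ne0$, $\varepsilon^2=0$, and $\varepsilon$ commutes with complex numbers and quaternions. $\mathbb{DC}=\{a_{st}+a_{\mathcal I}\varepsilon: a_{st},a_{\mathcal I}\in\mathbb C\}$ is the ring of dual complex numbers, with conjugation $\overline{a_{st}+a_{\mathcal I}\varepsilon}=\overline{a_{st}}+\overline{a_{\mathcal I}}\varepsilon$. $\mathbb Q$ denotes the real quaternions with imaginary units $\mathbf i,\mathbf j,\mathbf k$, and $\hat{\mathbb Q}=\{\tilde p_{st}+\tilde p_{\mathcal I}\varepsilon:\tilde p_{st},\tilde p_{\mathcal I}\in\mathbb Q\}$ the dual quaternions. $\mathbb C$ is identified with $\mathbb R+\mathbb R\mathbf i\subset\mathbb Q$, so $\mathbb{DC}\subset\hat{\mathbb Q}$. $\hat{\mathbb Q}^{m\times n}$ and $\mathbb{DC}^{m\times n}$ are the corresponding matrix sets; $^*$ is the conjugate transpose, and overlines on complex matrices denote entrywise conjugation. Every $\hat{\mathbf Q}\in\hat{\mathbb Q}^{m\times n}$ is uniquely $\hat{\mathbf Q}=(A_1+A_2\mathbf j)+(A_3+A_4\mathbf j)\varepsilon$ with $A_1,\dots,A_4\in\mathbb C^{m\times n}$. Its dual complex adjoint matrix is $$\mathcal J(\hat{\mathbf Q})=\begin{bmatrix}A_1&A_2\\-\overline{A_2}&\overline{A_1}\end{bmatrix}+\begin{bmatrix}A_3&A_4\\-\overline{A_4}&\overline{A_3}\end{bmatrix}\varepsilon\in\mathbb{DC}^{2m\times2n}.$$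 The bijection $\mathcal F:\hat{\mathbb Q}^{n\times1}\to\mathbb{DC}^{2n\times1}$ is, for $\mathbf v_1,\dots,\mathbf v_4\in\mathbb C^{n\times 1}$, $$\mathcal F(\mathbf v_1+\mathbf v_2\mathbf j+(\mathbf v_3+\mathbf v_4\mathbf j)\varepsilon)=\begin{bmatrix}\mathbf v_1\\-\overline{\mathbf v_2}\end{bmatrix}+\begin{bmatrix}\mathbf v_3\\-\overline{\mathbf v_4}\end{bmatrix}\varepsilon .$$ *)

theory Defs
  imports "HOL-Analysis.Analysis"
begin

section \<open>Dual numbers over a ring\<close>

text \<open>\<open>Dual a b\<close> stands for $a + b\varepsilon$.\<close>

datatype 'a dual_num = Dual (std_part: 'a) (inf_part: 'a)

lemma dual_num_eq_iff: "x = y \<longleftrightarrow> std_part x = std_part y \<and> inf_part x = inf_part y"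
  by (cases x; cases y) simp

instantiation dual_num :: (ring_1) ring_1
begin

definition "0 = Dual 0 0"
definition "1 = Dual 1 0"
definition "x + y = Dual (std_part x + std_part y) (inf_part x + inf_part y)"
definition "x - y = Dual (std_part x - std_part y) (inf_part x - inf_part y)"
definition "- x = Dual (- std_part x) (- inf_part x)"
definition "x * y =
  Dual (std_part x * std_part y) (std_part x * inf_part y + inf_part x * std_part y)"

instance
  by standard
    (auto simp: zero_dual_num_def one_dual_num_def plus_dual_num_def minus_dual_num_def
      uminus_dual_num_def times_dual_num_def dual_num_eq_iff algebra_simps)

end

instance dual_num :: (comm_ring_1) comm_ring_1
  by standard
    (simp_all add: one_dual_num_def plus_dual_num_def times_dual_num_def dual_num_eq_iff
      algebra_simps)

definition dual_of :: "'a::zero \<Rightarrow> 'a dual_num"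
  where "dual_of a = Dual a 0"

definition eps :: "'a::zero_neq_one dual_num"
  where "eps = Dual 0 1"

lemma Dual_eq: "Dual a b = dual_of a + dual_of b * eps" for a b :: "'a::ring_1"
  by (simp add: dual_of_def eps_def plus_dual_num_def times_dual_num_def)

lemma eps_nonzero: "(eps :: 'a::ring_1 dual_num) \<noteq> 0"
  by (simp add: eps_def zero_dual_num_def)

lemma eps_square: "(eps :: 'a::ring_1 dual_num) * eps = 0"
  by (simp add: eps_def zero_dual_num_def times_dual_num_def)

lemma eps_commute: "eps * x = x * (eps :: 'a::ring_1 dual_num)"
  by (simp add: eps_def times_dual_num_def)

type_synonym dcomplex = "complex dual_num"

definition dcnj :: "dcomplex \<Rightarrow> dcomplex"
  where "dcnj = map_dual_num cnj"


section \<open>Quaternions\<close>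

text \<open>\<open>Quat a b c d\<close> stands for $a + b\mathbf{i} + c\mathbf{j} + d\mathbf{k}$.\<close>

datatype quat = Quat (q1: real) (qi: real) (qj: real) (qk: real)

lemma quat_eq_iff: "x = y \<longleftrightarrow> q1 x = q1 y \<and> qi x = qi y \<and> qj x = qj y \<and> qk x = qk y"
  by (cases x; cases y) simp

instantiation quat :: ring_1
begin

definition "0 = Quat 0 0 0 0"
definition "1 = Quat 1 0 0 0"
definition "x + y = Quat (q1 x + q1 y) (qi x + qi y) (qj x + qj y) (qk x + qk y)"
definition "x - y = Quat (q1 x - q1 y) (qi x - qi y) (qj x - qj y) (qk x - qk y)"
definition "- x = Quat (- q1 x) (- qi x) (- qj x) (- qk x)"
definition "x * y = Quat
  (q1 x * q1 y - qi x * qi y - qj x * qj y - qk x * qk y)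
  (q1 x * qi y + qi x * q1 y + qj x * qk y - qk x * qj y)
  (q1 x * qj y - qi x * qk y + qj x * q1 y + qk x * qi y)
  (q1 x * qk y + qi x * qj y - qj x * qi y + qk x * q1 y)"

instance
  by standard
    (auto simp: zero_quat_def one_quat_def plus_quat_def minus_quat_def
      uminus_quat_def times_quat_def quat_eq_iff algebra_simps)

end

definition unit_i :: quat where "unit_i = Quat 0 1 0 0"
definition unit_j :: quat where "unit_j = Quat 0 0 1 0"
definition unit_k :: quat where "unit_k = Quat 0 0 0 1"

lemma quat_units:
  "unit_i * unit_i = - 1" "unit_j * unit_j = - 1" "unit_k * unit_k = - 1"
  "unit_i * unit_j = unit_k" "unit_j * unit_k = unit_i" "unit_k * unit_i = unit_j"
  "unit_j * unit_i = - unit_k" "unit_k * unit_j = - unit_i" "unit_i * unit_k = - unit_j"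
  by (simp_all add: unit_i_def unit_j_def unit_k_def times_quat_def one_quat_def uminus_quat_def)

definition quat_of_complex :: "complex \<Rightarrow> quat"
  where "quat_of_complex z = Quat (Re z) (Im z) 0 0"

text \<open>
  The two complex coordinates \<open>z\<close>, \<open>w\<close> of a quaternion $z + w\mathbf{j}$; since
  $\mathbf{i}\mathbf{j} = \mathbf{k}$, the second one collects the coefficients of
  $\mathbf{j}$ and $\mathbf{k}$.
\<close>

definition cpart1 :: "quat \<Rightarrow> complex" where "cpart1 q = Complex (q1 q) (qi q)"
definition cpart2 :: "quat \<Rightarrow> complex" where "cpart2 q = Complex (qj q) (qk q)"

lemma quat_eq_complex_parts_iff:
  "q = quat_of_complex z + quat_of_complex w * unit_j \<longleftrightarrow> z = cpart1 q \<and> w = cpart2 q"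
  by (cases q)
    (auto simp: quat_of_complex_def unit_j_def cpart1_def cpart2_def plus_quat_def
      times_quat_def complex_eq_iff)

type_synonym dquat = "quat dual_num"

definition dquat_of_dcomplex :: "dcomplex \<Rightarrow> dquat"
  where "dquat_of_dcomplex = map_dual_num quat_of_complex"

lemma dquat_of_dcomplex_hom:
  "dquat_of_dcomplex (x + y) = dquat_of_dcomplex x + dquat_of_dcomplex y"
  "dquat_of_dcomplex (x * y) = dquat_of_dcomplex x * dquat_of_dcomplex y"
  "dquat_of_dcomplex 1 = 1"
  "dquat_of_dcomplex eps = eps"
  by (cases x; cases y; simp add: dquat_of_dcomplex_def quat_of_complex_def plus_dual_num_def
      times_dual_num_def one_dual_num_def eps_def plus_quat_def times_quat_def one_quat_def
      zero_quat_def)+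

lemma inj_dquat_of_dcomplex: "inj dquat_of_dcomplex"
  by (auto simp: dquat_of_dcomplex_def quat_of_complex_def complex_eq_iff
      intro!: injI dual_num.inj_map_strong[of _ _ quat_of_complex quat_of_complex])

text \<open>
  The dual complex coordinates \<open>z\<close>, \<open>w\<close> of a dual quaternion $z + w\mathbf{j}$:
  for $(a_1 + a_2\mathbf{j}) + (a_3 + a_4\mathbf{j})\varepsilon$ they are
  $a_1 + a_3\varepsilon$ and $a_2 + a_4\varepsilon$.
\<close>

definition dcpart1 :: "dquat \<Rightarrow> dcomplex" where "dcpart1 = map_dual_num cpart1"
definition dcpart2 :: "dquat \<Rightarrow> dcomplex" where "dcpart2 = map_dual_num cpart2"

lemma dquat_eq_complex_parts_iff:
  "q = Dual (quat_of_complex a1 + quat_of_complex a2 * unit_j)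
            (quat_of_complex a3 + quat_of_complex a4 * unit_j)
   \<longleftrightarrow> dcpart1 q = Dual a1 a3 \<and> dcpart2 q = Dual a2 a4"
  by (cases q) (auto simp: quat_eq_complex_parts_iff dcpart1_def dcpart2_def)


section \<open>Vectors and matrices\<close>

definition scale_right :: "'a::times ^ 'n \<Rightarrow> 'a \<Rightarrow> 'a ^ 'n"  (infixl \<open>*sr\<close> 70)
  where "v *sr a = (\<chi> i. v $ i * a)"

definition conj_transpose :: "dcomplex ^ 'n ^ 'm \<Rightarrow> dcomplex ^ 'm ^ 'n"
  where "conj_transpose A = (\<chi> i j. dcnj (A $ j $ i))"

text \<open>
  Matrices with $2m$ rows and $2n$ columns are indexed by the sum types \<open>'m + 'm\<close> and
  \<open>'n + 'n\<close>: \<open>Inl\<close> selects the first block row (column) and \<open>Inr\<close> the second.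
  The standard part and the \<open>eps\<close> part have the same block shape, so both are given by one
  formula on dual complex entries.
\<close>

definition dc_adjoint :: "dquat ^ 'n ^ 'm \<Rightarrow> dcomplex ^ ('n + 'n) ^ ('m + 'm)"
  where "dc_adjoint Q = (\<chi> r c.
    (case (r, c) of
       (Inl s, Inl t) \<Rightarrow> dcpart1 (Q $ s $ t)
     | (Inl s, Inr t) \<Rightarrow> dcpart2 (Q $ s $ t)
     | (Inr s, Inl t) \<Rightarrow> - dcnj (dcpart2 (Q $ s $ t))
     | (Inr s, Inr t) \<Rightarrow> dcnj (dcpart1 (Q $ s $ t))))"

definition dc_vec :: "dquat ^ 'n \<Rightarrow> dcomplex ^ ('n + 'n)"
  where "dc_vec v = (\<chi> r.
    (case r of
       Inl s \<Rightarrow> dcpart1 (v $ s)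
     | Inr s \<Rightarrow> - dcnj (dcpart2 (v $ s))))"

end

theory Submission
  imports Defs
begin

text \<open>
  Write a dual quaternion vector as \<open>v = z + w j\<close> with \<open>z\<close>, \<open>w\<close> dual complex. From
  \<open>j a = dcnj a j\<close> one gets the product rule
  \<open>(a + b j) (z + w j) = (a z - b dcnj w) + (a w + b dcnj z) j\<close>. The map \<open>dc_vec\<close> stores
  \<open>(z, - dcnj w)\<close>, with the second coordinate conjugated because dual quaternion vectors form
  a \<^emph>\<open>right\<close> module: multiplying \<open>v\<close> by \<open>lam\<close> from the right multiplies \<open>w\<close> by
  \<open>dcnj lam\<close>, hence \<open>- dcnj w\<close> by \<open>lam\<close>. So \<open>dc_vec\<close> is an isomorphism from right scaling
  to ordinary scaling (\<open>dc_vec_scale_right\<close>), and the product rule says that it turns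
  left multiplication by \<open>Q\<close> into multiplication by the adjoint matrix
  (\<open>dc_vec_matrix_vector_mult\<close>). Since it is injective, the eigenvector equations of \<open>Q\<close>
  and of its adjoint correspond (\<open>right_eigen_iff_adjoint_eigen\<close>).

  The equation for \<open>u2\<close> is the same fact applied to \<open>v j\<close> and \<open>dcnj lam\<close>: as
  \<open>lam j = j dcnj lam\<close> and \<open>j\<close> is invertible, \<open>Q v = v lam\<close> holds exactly when
  \<open>Q (v j) = (v j) dcnj lam\<close> (\<open>right_eigen_times_unit_j_iff\<close>). Both equations are thus
  individually equivalent to \<open>Q v = v lam\<close>.

  Orthogonality has nothing to do with eigenvalues: \<open>v j = - w + z j\<close> is stored as
  \<open>(- w, - dcnj z)\<close>, and in the Hermitian product with \<open>(z, - dcnj w)\<close> the two blocks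
  contribute \<open>- dcnj z w\<close> and \<open>w dcnj z\<close>, which cancel row by row.
\<close>

section \<open>Dual complex coordinates of dual quaternions\<close>

lemma dcnj_simps [simp]:
  "dcnj (x + y) = dcnj x + dcnj y"
  "dcnj (x - y) = dcnj x - dcnj y"
  "dcnj (- x) = - dcnj x"
  "dcnj (x * y) = dcnj x * dcnj y"
  "dcnj 0 = 0"
  "dcnj (dcnj x) = x"
  by (cases x; cases y; simp add: dcnj_def plus_dual_num_def minus_dual_num_def
      uminus_dual_num_def times_dual_num_def zero_dual_num_def)+

lemma dcnj_one [simp]: "dcnj 1 = 1"
  by (simp add: dcnj_def one_dual_num_def)

lemma dcnj_sum: "dcnj (sum f A) = (\<Sum>x\<in>A. dcnj (f x))"
  by (induction A rule: infinite_finite_induct) simp_all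

lemma dcnj_eq_iff [simp]: "dcnj x = dcnj y \<longleftrightarrow> x = y"
  by (metis dcnj_simps(6))

lemma dcpart_add:
  "dcpart1 (p + q) = dcpart1 p + dcpart1 q"
  "dcpart2 (p + q) = dcpart2 p + dcpart2 q"
  by (cases p; cases q; simp add: dcpart1_def dcpart2_def cpart1_def cpart2_def
      plus_dual_num_def plus_quat_def complex_eq_iff)+

lemma dcpart_zero: "dcpart1 0 = 0" "dcpart2 0 = 0"
  by (simp_all add: dcpart1_def dcpart2_def cpart1_def cpart2_def
      zero_dual_num_def zero_quat_def complex_eq_iff)

lemma dcpart_sum:
  "dcpart1 (sum f A) = (\<Sum>x\<in>A. dcpart1 (f x))"
  "dcpart2 (sum f A) = (\<Sum>x\<in>A. dcpart2 (f x))"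
  by (induction A rule: infinite_finite_induct) (simp_all add: dcpart_add dcpart_zero)

text \<open>
  Moving \<open>j\<close> past a dual complex number conjugates it; this and \<open>j j = - 1\<close> produce the
  conjugates and the minus sign, the same ones that appear in the block pattern of the
  adjoint matrix.
\<close>

lemma dcpart_mult:
  "dcpart1 (p * q) = dcpart1 p * dcpart1 q - dcpart2 p * dcnj (dcpart2 q)"
  "dcpart2 (p * q) = dcpart1 p * dcpart2 q + dcpart2 p * dcnj (dcpart1 q)"
  by (cases p; cases q; simp add: dcpart1_def dcpart2_def cpart1_def cpart2_def dcnj_def
      times_dual_num_def plus_dual_num_def minus_dual_num_def plus_quat_def times_quat_def
      complex_eq_iff algebra_simps)+

lemma dcpart_dquat_of_dcomplex:
  "dcpart1 (dquat_of_dcomplex a) = a"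
  "dcpart2 (dquat_of_dcomplex a) = 0"
  by (cases a; simp add: dcpart1_def dcpart2_def cpart1_def cpart2_def dquat_of_dcomplex_def
      quat_of_complex_def zero_dual_num_def complex_eq_iff)+

lemma dcpart_unit_j:
  "dcpart1 (dual_of unit_j) = 0"
  "dcpart2 (dual_of unit_j) = 1"
  by (simp_all add: dcpart1_def dcpart2_def cpart1_def cpart2_def dual_of_def unit_j_def
      zero_quat_def zero_dual_num_def one_dual_num_def complex_eq_iff)

lemma dquat_eqI:
  assumes "dcpart1 p = dcpart1 q" "dcpart2 p = dcpart2 q"
  shows "p = q"
  using assms
  by (cases p; cases q)
    (simp add: dcpart1_def dcpart2_def cpart1_def cpart2_def quat_eq_iff)

section \<open>The adjoint matrix as a change of coordinates\<close>

lemma inj_dc_vec: "inj dc_vec"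
proof (rule injI)
  fix v w :: "dquat ^ 'n"
  assume eq: "dc_vec v = dc_vec w"
  show "v = w"
  proof (rule vec_eq_iff[THEN iffD2], rule allI)
    fix s
    have "dc_vec v $ Inl s = dc_vec w $ Inl s" "dc_vec v $ Inr s = dc_vec w $ Inr s"
      by (simp_all add: eq)
    then show "v $ s = w $ s"
      by (intro dquat_eqI) (simp_all add: dc_vec_def)
  qed
qed

lemma dc_vec_scale_right: "dc_vec (v *sr dquat_of_dcomplex a) = a *s dc_vec v"
  by (auto simp: vec_eq_iff dc_vec_def scale_right_def dcpart_mult dcpart_dquat_of_dcomplex
      mult.commute split: sum.split)

lemma sum_UNIV_sum_type:
  fixes f :: "'a::finite + 'b::finite \<Rightarrow> 'c::comm_monoid_add"
  shows "(\<Sum>x\<in>UNIV. f x) = (\<Sum>s\<in>UNIV. f (Inl s)) + (\<Sum>s\<in>UNIV. f (Inr s))"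
  by (simp add: UNIV_Plus_UNIV[symmetric] sum.Plus del: UNIV_Plus_UNIV)

text \<open>
  Both block rows are instances of the product rule for \<open>Q $ s $ t * v $ t\<close>: the upper one
  is its first coordinate, the lower one its second coordinate conjugated and negated, which
  is why the lower blocks of the adjoint carry conjugates.
\<close>

lemma dc_vec_matrix_vector_mult:
  fixes Q :: "dquat ^ 'n::finite ^ 'm::finite"
  shows "dc_vec (Q *v v) = dc_adjoint Q *v dc_vec v"
proof (rule vec_eq_iff[THEN iffD2], rule allI)
  fix r :: "'m + 'm"
  show "dc_vec (Q *v v) $ r = (dc_adjoint Q *v dc_vec v) $ r"
    by (cases r)
      (simp_all add: dc_vec_def dc_adjoint_def matrix_vector_mult_def sum_UNIV_sum_type
        dcpart_sum dcpart_mult dcnj_sum sum.distrib sum_negf sum_subtractf)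
qed

lemma right_eigen_iff_adjoint_eigen:
  fixes Q :: "dquat ^ 'n::finite ^ 'n"
  shows "Q *v v = v *sr dquat_of_dcomplex a \<longleftrightarrow> dc_adjoint Q *v dc_vec v = a *s dc_vec v"
  by (simp add: dc_vec_matrix_vector_mult[symmetric] dc_vec_scale_right[symmetric]
      inj_eq[OF inj_dc_vec])

section \<open>Right multiplication by the unit j\<close>

lemma dcomplex_mult_unit_j:
  "dquat_of_dcomplex a * dual_of unit_j = dual_of unit_j * dquat_of_dcomplex (dcnj a)"
  by (rule dquat_eqI) (simp_all add: dcpart_mult dcpart_unit_j dcpart_dquat_of_dcomplex)

lemma scale_right_scale_right:
  fixes v :: "'a::semigroup_mult ^ 'n"
  shows "v *sr a *sr b = v *sr (a * b)"
  by (simp add: scale_right_def vec_eq_iff mult.assoc)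

lemma matrix_vector_mult_scale_right:
  fixes A :: "'a::semiring_1 ^ 'n::finite ^ 'm"
  shows "A *v (v *sr a) = (A *v v) *sr a"
  by (simp add: scale_right_def matrix_vector_mult_def vec_eq_iff sum_distrib_right mult.assoc)

lemma scale_right_unit_j_eq_iff:
  fixes v w :: "dquat ^ 'n"
  shows "v *sr dual_of unit_j = w *sr dual_of unit_j \<longleftrightarrow> v = w"
proof
  assume eq: "v *sr dual_of unit_j = w *sr dual_of unit_j"
  have inv: "x *sr dual_of unit_j *sr (- dual_of unit_j) = x" for x :: "dquat ^ 'n"
  proof -
    have "dual_of unit_j * (- dual_of unit_j) = 1"
      by (simp add: dual_of_def times_dual_num_def uminus_dual_num_def one_dual_num_def quat_units)
    then show ?thesis
      by (simp only: scale_right_scale_right) (simp add: scale_right_def)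
  qed
  show "v = w"
    by (metis eq inv)
qed simp

text \<open>
  Right eigenvalues are only determined up to similarity: passing from \<open>v\<close> to \<open>v j\<close>
  replaces \<open>a\<close> by the similar number \<open>j\<inverse> a j\<close>, which is its conjugate.
\<close>

lemma right_eigen_times_unit_j_iff:
  fixes Q :: "dquat ^ 'n::finite ^ 'n"
  shows "Q *v (v *sr dual_of unit_j) = v *sr dual_of unit_j *sr dquat_of_dcomplex (dcnj a)
    \<longleftrightarrow> Q *v v = v *sr dquat_of_dcomplex a"
  by (simp only: matrix_vector_mult_scale_right scale_right_scale_right
      dcomplex_mult_unit_j[symmetric])
    (simp only: scale_right_scale_right[symmetric] scale_right_unit_j_eq_iff)

lemma dc_vec_times_unit_j_orthogonal:
  fixes v :: "dquat ^ 'n::finite"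
  defines "w \<equiv> v *sr dual_of unit_j"
  shows "conj_transpose (columnvector (dc_vec v)) ** columnvector (dc_vec w)
      = (0 :: dcomplex ^ 1 ^ 1)"
    and "conj_transpose (columnvector (dc_vec w)) ** columnvector (dc_vec v)
      = (0 :: dcomplex ^ 1 ^ 1)"
  by (simp_all add: w_def vec_eq_iff matrix_matrix_mult_def conj_transpose_def columnvector_def
      sum_UNIV_sum_type dc_vec_def scale_right_def dcpart_mult dcpart_unit_j
      sum_negf mult.commute)

theorem theorem1:
  fixes Q :: "dquat ^ 'n::finite ^ 'n"
    and v :: "dquat ^ 'n"
    and lam :: dcomplex
    and P :: "dcomplex ^ ('n + 'n) ^ ('n + 'n)"
    and u1 u2 :: "dcomplex ^ ('n + 'n)"
  assumes "P = dc_adjoint Q"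
    and "u1 = dc_vec v"
    and "u2 = dc_vec (v *sr dual_of unit_j)"
  shows "(Q *v v = v *sr dquat_of_dcomplex lam
            \<longleftrightarrow> P *v u1 = lam *s u1 \<or> P *v u2 = dcnj lam *s u2)
       \<and> (P *v u1 = lam *s u1 \<longleftrightarrow> P *v u2 = dcnj lam *s u2)
       \<and> conj_transpose (columnvector u1) ** columnvector u2 = (0 :: dcomplex ^ 1 ^ 1)
       \<and> conj_transpose (columnvector u2) ** columnvector u1 = (0 :: dcomplex ^ 1 ^ 1)"
proof -
  have first: "P *v u1 = lam *s u1 \<longleftrightarrow> Q *v v = v *sr dquat_of_dcomplex lam"
    by (simp add: assms right_eigen_iff_adjoint_eigen)
  have second: "P *v u2 = dcnj lam *s u2 \<longleftrightarrow> Q *v v = v *sr dquat_of_dcomplex lam"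
    by (simp only: assms right_eigen_iff_adjoint_eigen[symmetric] right_eigen_times_unit_j_iff)
  show ?thesis
    unfolding first second
    using dc_vec_times_unit_j_orthogonal[of v] by (simp add: assms(2,3))
qed

end
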